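(* Let $n\ge 1$. For every $r$ with $1\le r\le 2n+1$, $$|\mathcal D^r_{2n+1,0}|=(n!)^2\left\lceil\frac r2\right\rceil.$$
   Context: $\mathcal D^r_{2n+1,0}$ is the set of permutations $\sigma\in\mathfrak S_{2n+1}$ such that $\sigma(i)\le i$ whenever $i$ is even, and $\sigma(1)=r$. *)

theory Defs
  imports Complex_Main "HOL-Combinatorics.Permutations"
begin

(* D0 n r is the set written D^r with lower index (2n+1, 0): the parameter n is not the size.
   S_(2n+1) is the set of bijections of nat fixing every point outside {1..2n+1}. *)
definition D0 :: "nat \<Rightarrow> nat \<Rightarrow> (nat \<Rightarrow> nat) set" where
  "D0 n r = {\<sigma>. \<sigma> permutes {1..2 * n + 1} \<and>
                  (\<forall>i\<in>{1..2 * n + 1}. even i \<longrightarrow> \<sigma> i \<le> i) \<and> \<sigma> 1 = r}"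

end

theory Submission
  imports Defs
begin

text \<open>
  Choose the values of the permutation greedily: first at 1, then at the even positions
  2, 4, \<dots>, 2n, then at the odd positions 3, 5, \<dots>, 2n + 1. In this order the sets of allowed values
  form an increasing chain (once \<open>r\<close> is added to each of them), so every earlier choice uses up exactly
  one of the later options and the number of choices at each step does not depend on the previous ones.
\<close>

text \<open>One step of the greedy choice: injectivity at the new point only forbids values already
  taken on \<open>Q\<close>. The set of remaining values depends on \<open>f\<close>, hence a
  dependent sum rather than a product.\<close>

lemma bij_betw_inj_on_PiE_insert:
  assumes "p \<notin> Q"
  shows "bij_betw (\<lambda>(f, y). f(p := y))
    (SIGMA f:{f \<in> Pi\<^sub>E Q S. inj_on f Q}. S p - f ` Q)
    {f \<in> Pi\<^sub>E (insert p Q) S. inj_on f (insert p Q)}" (is "bij_betw ?up ?P ?G")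
\<comment> \<open>Resetting \<open>p\<close> to \<open>undefined\<close> makes the restricted
  function extensional on \<open>Q\<close> again.\<close>
proof (rule bij_betwI[where g = "\<lambda>g. (g(p := undefined), g p)"])
  show "?up \<in> ?P \<rightarrow> ?G"
  proof (intro funcsetI)
    fix x assume "x \<in> ?P"
    then obtain f y where x: "x = (f, y)" and f: "f \<in> Pi\<^sub>E Q S" "inj_on f Q"
      and y: "y \<in> S p" "y \<notin> f ` Q"
      by auto
    have "(f(p := y)) ` Q = f ` Q"
      using assms by (intro image_cong) auto
    moreover have "inj_on (f(p := y)) Q"
      using f(2) y(2) by (rule inj_on_fun_updI)
    ultimately have "inj_on (f(p := y)) (insert p Q)"
      using y(2) assms by (simp add: inj_on_insert)
    with PiE_fun_upd[OF y(1) f(1)] show "?up x \<in> ?G"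
      by (simp add: x)
  qed
  show "(\<lambda>g. (g(p := undefined), g p)) \<in> ?G \<rightarrow> ?P"
  proof (intro funcsetI)
    fix g assume "g \<in> ?G"
    then have g: "g \<in> Pi\<^sub>E (insert p Q) S" "inj_on g (insert p Q)"
      by auto
    have same: "(g(p := undefined)) x = g x" if "x \<in> Q" for x
      using assms that by auto
    have "g(p := undefined) \<in> Pi\<^sub>E Q S"
      using g(1) assms by (rule fun_upd_in_PiE[rotated])
    moreover have "inj_on (g(p := undefined)) Q"
      using g(2) same by (simp add: inj_on_def)
    moreover have "g p \<in> S p - (g(p := undefined)) ` Q"
      using g assms image_cong[OF refl same, of Q] by auto
    ultimately show "(g(p := undefined), g p) \<in> ?P"
      by blast
  qed
  show "(\<lambda>g. (g(p := undefined), g p)) (?up x) = x" if "x \<in> ?P" for x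
    using that assms by (auto simp: PiE_iff extensional_def fun_eq_iff)
  show "?up (g(p := undefined), g p) = g" for g
    by simp
qed

text \<open>\<open>pos\<close> lists the positions in order of choice. Since the sets increase along
  it, the \<open>i\<close> distinct values chosen before \<open>pos i\<close> all lie in
  \<open>S (pos i)\<close>, so exactly \<open>card (S (pos i)) - i\<close> values remain, whatever
  the earlier choices were.\<close>

lemma card_inj_on_PiE_chain:
  fixes pos :: "nat \<Rightarrow> 'a" and S :: "'a \<Rightarrow> 'b set"
  assumes "inj_on pos {..<m}"
    and "\<And>i. i < m \<Longrightarrow> finite (S (pos i))"
    and "\<And>i j. i \<le> j \<Longrightarrow> j < m \<Longrightarrow> S (pos i) \<subseteq> S (pos j)"
  shows "finite {f \<in> Pi\<^sub>E (pos ` {..<m}) S. inj_on f (pos ` {..<m})} \<and>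
    card {f \<in> Pi\<^sub>E (pos ` {..<m}) S. inj_on f (pos ` {..<m})} = (\<Prod>i<m. card (S (pos i)) - i)"
  using assms
proof (induction m)
  case 0
  have "{f \<in> Pi\<^sub>E (pos ` {..<0}) S. inj_on f (pos ` {..<0})} = {\<lambda>_. undefined}"
    by auto
  then show ?case by simp
next
  case (Suc m)
  let ?Q = "pos ` {..<m}" and ?p = "pos m"
  let ?F = "{f \<in> Pi\<^sub>E ?Q S. inj_on f ?Q}"
  let ?G = "{f \<in> Pi\<^sub>E (insert ?p ?Q) S. inj_on f (insert ?p ?Q)}"
  let ?P = "SIGMA f:?F. S ?p - f ` ?Q"
  have inj: "inj_on pos {..<m}"
    using Suc.prems(1) by (rule inj_on_subset) auto
  have IH: "finite ?F" "card ?F = (\<Prod>i<m. card (S (pos i)) - i)"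
    using Suc.IH[OF inj] Suc.prems(2,3) by auto
  have p: "?p \<notin> ?Q"
    using Suc.prems(1) by (force simp: inj_on_def)
  note bij = bij_betw_inj_on_PiE_insert[OF p, of S]
  have card_fib: "card (S ?p - f ` ?Q) = card (S ?p) - m" if "f \<in> ?F" for f
  proof -
    have "f ` ?Q \<subseteq> S ?p"
    proof (intro image_subsetI, elim imageE)
      fix x i assume "x = pos i" "i \<in> {..<m}"
      then show "f x \<in> S ?p"
        using that Suc.prems(3)[of i m] by (auto simp: PiE_iff)
    qed
    moreover have "card (f ` ?Q) = m"
      using that inj by (simp add: card_image)
    ultimately show ?thesis
      by (simp add: card_Diff_subset)
  qed
  have fin_fib: "\<forall>f\<in>?F. finite (S ?p - f ` ?Q)"
    using Suc.prems(2)[of m] by simp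
  have "finite ?P"
    using IH(1) fin_fib by (intro finite_SigmaI) auto
  then have "finite ?G"
    using bij bij_betw_finite by blast
  moreover have "card ?G = card ?P"
    using bij by (rule bij_betw_same_card[symmetric])
  moreover have "card ?P = (\<Sum>f\<in>?F. card (S ?p) - m)"
    using card_SigmaI[OF IH(1) fin_fib] card_fib by simp
  ultimately show ?case
    using IH(2) by (simp add: lessThan_Suc)
qed

text \<open>Permutations are the identity outside \<open>A\<close>, extensional functions are
  \<open>undefined\<close> there; restricting to \<open>A\<close> and extending by the identity
  translate between the two. An injective self-map of the finite set \<open>A\<close> is already
  bijective.\<close>

lemma card_permutes_restricted:
  assumes "finite A" and "\<And>x. x \<in> A \<Longrightarrow> S x \<subseteq> A"
  shows "card {\<sigma>. \<sigma> permutes A \<and> (\<forall>x\<in>A. \<sigma> x \<in> S x)} = card {f \<in> Pi\<^sub>E A S. inj_on f A}"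
proof (rule bij_betw_same_card)
  show "bij_betw (\<lambda>\<sigma>. restrict \<sigma> A)
      {\<sigma>. \<sigma> permutes A \<and> (\<forall>x\<in>A. \<sigma> x \<in> S x)} {f \<in> Pi\<^sub>E A S. inj_on f A}"
  proof (rule bij_betwI[where g = "\<lambda>f x. if x \<in> A then f x else x"])
    show "(\<lambda>f x. if x \<in> A then f x else x) \<in> {f \<in> Pi\<^sub>E A S. inj_on f A}
        \<rightarrow> {\<sigma>. \<sigma> permutes A \<and> (\<forall>x\<in>A. \<sigma> x \<in> S x)}"
    proof (intro funcsetI CollectI conjI ballI)
      fix f assume f: "f \<in> {f \<in> Pi\<^sub>E A S. inj_on f A}"
      then have "f ` A \<subseteq> A"
        using assms(2) by (fastforce simp: PiE_iff)
      then have "bij_betw f A A"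
        using f assms(1) by (simp add: bij_betw_def endo_inj_surj)
      then have "bij_betw (\<lambda>x. if x \<in> A then f x else x) A A"
        by (rule bij_betw_cong[THEN iffD1, rotated]) simp
      then show "(\<lambda>x. if x \<in> A then f x else x) permutes A"
        by (rule bij_imp_permutes) simp
    qed (auto simp: PiE_iff)
  qed (auto simp: PiE_iff fun_eq_iff extensional_def permutes_not_in
        intro: permutes_inj_on)
qed

text \<open>With c = \<open>(r + 1) div 2\<close>, the factor is \<open>k + 1\<close> for k < c and
  \<open>k\<close> from c on. Relative to \<open>fact m\<close>, the factors (k + 1) / k telescope
  to m + 1 until they stop at c, which the minimum records.\<close>

lemma prod_even_choices:
  fixes r m :: nat
  assumes "1 \<le> r"
  shows "(\<Prod>k=1..m. if r \<le> 2 * k then k else k + 1) = fact m * min (m + 1) ((r + 1) div 2)"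
proof (induction m)
  case 0
  then show ?case using assms by simp
next
  case (Suc m)
  have "min (m + 1) ((r + 1) div 2) * (if r \<le> 2 * Suc m then Suc m else Suc m + 1)
      = Suc m * min (Suc m + 1) ((r + 1) div 2)"
  proof (cases "r \<le> 2 * Suc m")
    case True
    then have "(r + 1) div 2 \<le> m + 1" by simp
    with True show ?thesis by (simp add: min_def)
  next
    case False
    then have "m + 2 \<le> (r + 1) div 2" by simp
    with False show ?thesis by (simp add: min_def)
  qed
  with Suc.IH show ?case
    by (simp add: algebra_simps)
qed

definition choice_order :: "nat \<Rightarrow> nat \<Rightarrow> nat" where
  "choice_order n i = (if i = 0 then 1 else if i \<le> n then 2 * i else 2 * (i - n) + 1)"

lemma bij_betw_choice_order: "bij_betw (choice_order n) {..<2 * n + 1} {1..2 * n + 1}"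
proof -
  have "inj_on (choice_order n) {..<2 * n + 1}"
    unfolding inj_on_def choice_order_def by auto presburger+
  moreover have "choice_order n ` {..<2 * n + 1} \<subseteq> {1..2 * n + 1}"
    by (auto simp: choice_order_def)
  ultimately show ?thesis
    by (simp add: bij_betw_def card_image card_subset_eq)
qed

definition allowed_values :: "nat \<Rightarrow> nat \<Rightarrow> nat \<Rightarrow> nat set" where
  "allowed_values n r i =
     (if i = 1 then {r} else if even i then insert r {1..i} else {1..2 * n + 1})"

text \<open>Adding \<open>r\<close> to the options at even positions makes the sets a chain and
  admits no new permutation: the value \<open>r\<close> is taken at 1, so injectivity excludes it
  elsewhere.\<close>

lemma D0_eq_allowed_values:
  assumes "r \<le> 2 * n + 1"
  shows "D0 n r =
    {\<sigma>. \<sigma> permutes {1..2 * n + 1} \<and> (\<forall>i\<in>{1..2 * n + 1}. \<sigma> i \<in> allowed_values n r i)}"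
    (is "_ = ?R")
proof (intro equalityI subsetI)
  fix \<sigma> assume \<sigma>: "\<sigma> \<in> D0 n r"
  have "\<sigma> i \<in> allowed_values n r i" if "i \<in> {1..2 * n + 1}" for i
    using \<sigma> that permutes_in_image[of \<sigma> "{1..2 * n + 1}" i]
    by (auto simp: D0_def allowed_values_def)
  with \<sigma> show "\<sigma> \<in> ?R"
    by (auto simp: D0_def)
next
  fix \<sigma> assume \<sigma>: "\<sigma> \<in> ?R"
  then have one: "\<sigma> 1 = r"
    by (auto simp: allowed_values_def dest!: bspec[where x = 1])
  have "\<sigma> i \<le> i" if i: "i \<in> {1..2 * n + 1}" "even i" for i
  proof -
    have "i \<noteq> 1"
      using i(2) by auto
    moreover from this have "\<sigma> i \<noteq> r"
      using \<sigma> one permutes_inj[of \<sigma> "{1..2 * n + 1}"] by (auto dest: injD)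
    moreover have "\<sigma> i \<in> allowed_values n r i"
      using \<sigma> i by blast
    ultimately show ?thesis
      using i(2) by (auto simp: allowed_values_def)
  qed
  with \<sigma> one show "\<sigma> \<in> D0 n r"
    by (auto simp: D0_def)
qed

text \<open>The even positions contribute \<open>fact n * ((r + 1) div 2)\<close> and the odd
  positions from 3 on contribute another \<open>fact n\<close>.\<close>

lemma card_D0:
  assumes "1 \<le> r" and "r \<le> 2 * n + 1"
  shows "card (D0 n r) = (fact n)\<^sup>2 * ((r + 1) div 2)"
proof -
  let ?A = "{1..2 * n + 1}" and ?S = "allowed_values n r" and ?p = "choice_order n"
  have "card (D0 n r) = card {f \<in> Pi\<^sub>E ?A ?S. inj_on f ?A}"
    unfolding D0_eq_allowed_values[OF assms(2)] using assms
    by (intro card_permutes_restricted) (auto simp: allowed_values_def split: if_splits)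
  also have "\<dots> = (\<Prod>i<2 * n + 1. card (?S (?p i)) - i)"
  proof -
    \<comment> \<open>The bounds on \<open>r\<close> ensure that the sets containing
      \<open>r\<close> lie in the full range allowed at the later odd positions.\<close>
    have "?S (?p i) \<subseteq> ?S (?p j)" if "i \<le> j" "j < 2 * n + 1" for i j
      using that assms by (auto simp: allowed_values_def choice_order_def split: if_splits)
    moreover have "finite (?S (?p i))" for i
      by (simp add: allowed_values_def)
    ultimately show ?thesis
      using card_inj_on_PiE_chain[of ?p "2 * n + 1" ?S] bij_betw_choice_order[of n]
      by (simp add: bij_betw_def)
  qed
  \<comment> \<open>The index 0 drops out: position 1 has the single option \<open>r\<close>, giving
    a factor 1.\<close>
  also have "\<dots> = (\<Prod>i\<in>{1..n} \<union> {n+1..2 * n}. card (?S (?p i)) - i)"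
    by (rule prod.mono_neutral_right) (auto simp: allowed_values_def choice_order_def)
  also have "\<dots> = (\<Prod>i=1..n. card (?S (?p i)) - i) * (\<Prod>i=n+1..2 * n. card (?S (?p i)) - i)"
    by (rule prod.union_disjoint) auto
  \<comment> \<open>Position 2k has 2k options, or 2k + 1 if \<open>r\<close> exceeds 2k, and k of
    them are used up.\<close>
  also have "(\<Prod>i=1..n. card (?S (?p i)) - i) = (\<Prod>k=1..n. if r \<le> 2 * k then k else k + 1)"
    using assms(1)
    by (intro prod.cong)
      (auto simp: allowed_values_def choice_order_def card_insert_if)
  \<comment> \<open>From \<open>r \<le> 2 * n + 1\<close> it follows that
    \<open>(r + 1) div 2\<close> is at most \<open>n + 1\<close>, so it is the minimum.\<close>
  also have "\<dots> = fact n * ((r + 1) div 2)"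
    using assms by (subst prod_even_choices) (auto simp: min_def)
  also have "(\<Prod>i=n+1..2 * n. card (?S (?p i)) - i) = (\<Prod>i=n+1..2 * n. 2 * n + 1 - i)"
    by (intro prod.cong) (auto simp: allowed_values_def choice_order_def)
  \<comment> \<open>The reflection of i to 2n + 1 - i maps the index range onto 1, ..., n.\<close>
  also have "\<dots> = fact n"
    unfolding fact_prod of_nat_id
    by (rule prod.reindex_bij_witness[where i = "\<lambda>k. 2 * n + 1 - k" and j = "\<lambda>k. 2 * n + 1 - k"]) auto
  finally show ?thesis
    by (simp add: power2_eq_square)
qed

theorem theorem6p1:
  fixes n r :: nat
  assumes "n \<ge> 1" and "1 \<le> r" and "r \<le> 2 * n + 1"
  shows "int (card (D0 n r)) = (fact n)\<^sup>2 * \<lceil>real r / 2\<rceil>"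
proof -
  have "\<lceil>real r / 2\<rceil> = int ((r + 1) div 2)"
    by (cases "even r") (auto elim!: evenE oddE simp: ceiling_eq_iff)
  then show ?thesis
    using card_D0[OF assms(2,3)] by simp
qed

end
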